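(* Let $m\ge1$ be an integer, let $X_1,X_2,\dots$ be i.i.d. beta$(1,m)$ random variables, $S_n=X_1+\dots+X_n$, and let $N(t)=\sum_{n\ge1}1[S_n\le t]$ be the associated renewal process, with mean function $M(t)=\mathbb{E}[N(t)]$. Let $\alpha_1,\dots,\alpha_m$ be the $m$ distinct complex roots of the exponential polynomial $E_m(x)=\sum_{k=0}^m x^k/k!$. Then for $t\in[0,1]$, $$M(t)=-1-\sum_{k=1}^m\alpha_k^{-1}e^{-\alpha_k t}.$$
   Context: The beta$(1,m)$ distribution has density $m(1-x)^{m-1}$ on $(0,1)$. $1[\cdot]$ denotes the indicator of an event. *)

theory Defs
  imports "HOL-Probability.Probability"
begin

definition beta_1_density :: "nat \<Rightarrow> real \<Rightarrow> real" where
  "beta_1_density m x = (if 0 < x \<and> x < 1 then real m * (1 - x) ^ (m - 1) else 0)"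

definition partial_sum :: "(nat \<Rightarrow> 'a \<Rightarrow> real) \<Rightarrow> nat \<Rightarrow> 'a \<Rightarrow> real" where
  "partial_sum X n \<omega> = (\<Sum>i=1..n. X i \<omega>)"

(* The series is taken in ennreal, so a sample path with infinitely many renewals in
   [0, t] is counted as top rather than as the default value of a divergent real series.
   The summation index is shifted by one: the sum ranges over S_1, S_2, ... *)
definition renewal_count :: "(nat \<Rightarrow> 'a \<Rightarrow> real) \<Rightarrow> real \<Rightarrow> 'a \<Rightarrow> ennreal" where
  "renewal_count X t \<omega> = (\<Sum>n. indicator {\<omega>. partial_sum X (Suc n) \<omega> \<le> t} \<omega>)"

definition renewal_mean :: "'a measure \<Rightarrow> (nat \<Rightarrow> 'a \<Rightarrow> real) \<Rightarrow> real \<Rightarrow> ennreal" where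
  "renewal_mean P X t = (\<integral>\<^sup>+ \<omega>. renewal_count X t \<omega> \<partial>P)"

definition exp_polynomial :: "nat \<Rightarrow> complex \<Rightarrow> complex" where
  "exp_polynomial m x = (\<Sum>k\<le>m. x ^ k / fact k)"

definition exp_polynomial_roots :: "nat \<Rightarrow> complex set" where
  "exp_polynomial_roots m = {x. exp_polynomial m x = 0}"

end

theory Submission
  imports Defs "HOL-Computational_Algebra.Fundamental_Theorem_Algebra"
begin

text \<open>
  Let \<open>f\<close> be the beta density and put \<open>U(s) = - (\<Sum>\<alpha>. exp (- \<alpha> s) / \<alpha>)\<close> for \<open>0 \<le> s \<le> 1\<close> and
  \<open>U(s) = 0\<close> otherwise. The claim is that \<open>U = 1 + M\<close> on the unit interval. The proof has an
  analytic half and a probabilistic half.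

  Analytically, \<open>U\<close> solves the renewal equation
  \<open>(\<integral> f(x) U(s - x) dx) = U(s) - 1\<close> for \<open>0 \<le> s \<le> 1\<close> (lemma \<open>beta_renewal_equation\<close>).
  For a root \<open>\<alpha>\<close> of \<open>E\<^sub>m(y) = (\<Sum>k\<le>m. y\<^sup>k / k!)\<close>, the function
  \<open>m! \<alpha>\<^sup>-\<^sup>m exp (- \<alpha> (s - x)) E\<^sub>m\<^sub>-\<^sub>1(\<alpha> (1 - x))\<close> is an antiderivative in \<open>x\<close> of
  \<open>m (1 - x)\<^sup>m\<^sup>-\<^sup>1 exp (- \<alpha> (s - x))\<close>, and \<open>E\<^sub>m\<^sub>-\<^sub>1(\<alpha>) = - \<alpha>\<^sup>m / m!\<close> gives its value at \<open>0\<close>. Summing over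
  the roots reduces the renewal equation to
  \<open>(\<Sum>\<alpha>. m! \<alpha>\<^sup>-\<^sup>m\<^sup>-\<^sup>1 E\<^sub>m\<^sub>-\<^sub>1(c \<alpha>)) = 1\<close> (lemma \<open>sum_roots_exp_polynomial\<close>). This is Lagrange
  interpolation of the polynomial \<open>E\<^sub>m\<^sub>-\<^sub>1(c y)\<close> at the \<open>m\<close> distinct roots, evaluated at \<open>y = 0\<close>:
  the weights are explicit because \<open>E\<^sub>m' = E\<^sub>m\<^sub>-\<^sub>1\<close> is known at the roots and \<open>E\<^sub>m(0) = 1\<close>.

  Probabilistically, let \<open>r\<^sub>n\<close> be the expectation of \<open>U(t - S\<^sub>n)\<close>, so that \<open>r\<^sub>0 = U(t)\<close>. Conditioning
  on \<open>S\<^sub>n\<close> turns the renewal equation into \<open>r\<^sub>n\<^sub>+\<^sub>1 = r\<^sub>n - P(S\<^sub>n \<le> t)\<close>, so the partial sums of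
  \<open>P(S\<^sub>n \<le> t)\<close> telescope to \<open>U(t) - r\<^sub>n\<close>. As \<open>U\<close> is bounded, by \<open>C\<close> say, \<open>\<bar>r\<^sub>n\<bar>\<close> is at most
  \<open>C P(S\<^sub>n \<le> t)\<close>. This bounds the partial sums, hence \<open>P(S\<^sub>n \<le> t)\<close> is summable, hence tends to
  \<open>0\<close>, hence so does \<open>r\<^sub>n\<close> (lemma \<open>renewal_sums\<close>). The term \<open>n = 0\<close> of the series is \<open>1\<close>,
  and the others add up to \<open>M(t)\<close>.
\<close>

section \<open>The truncated exponential and its roots\<close>

lemma exp_polynomial_Suc:
  "exp_polynomial (Suc n) x = exp_polynomial n x + x ^ Suc n / fact (Suc n)"
  by (simp add: exp_polynomial_def)

lemma exp_polynomial_0 [simp]: "exp_polynomial m 0 = 1"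
proof -
  have "exp_polynomial m 0 = (\<Sum>k\<le>m. if k = 0 then 1 else 0)"
    unfolding exp_polynomial_def by (intro sum.cong) auto
  then show ?thesis by simp
qed

lemma has_field_derivative_exp_polynomial:
  "(exp_polynomial (Suc n) has_field_derivative exp_polynomial n x) (at x)"
proof (induction n)
  case 0
  show ?case
    unfolding exp_polynomial_def by (auto intro!: derivative_eq_intros)
next
  case (Suc n)
  have "exp_polynomial (Suc (Suc n)) =
      (\<lambda>x. exp_polynomial (Suc n) x + x ^ Suc (Suc n) / fact (Suc (Suc n)))"
    by (simp add: exp_polynomial_Suc fun_eq_iff)
  moreover have "((\<lambda>x. exp_polynomial (Suc n) x + x ^ Suc (Suc n) / fact (Suc (Suc n)))
      has_field_derivative exp_polynomial n x + x ^ Suc n / fact (Suc n)) (at x)"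
  proof (intro DERIV_add Suc)
    have "((\<lambda>x. x ^ Suc (Suc n) / fact (Suc (Suc n))) has_field_derivative
        of_nat (Suc (Suc n)) * x ^ Suc n / fact (Suc (Suc n))) (at x)"
      using DERIV_power[OF DERIV_ident, of "Suc (Suc n)" x UNIV]
      by (intro DERIV_cdivide) (simp del: of_nat_Suc power_Suc)
    then show "((\<lambda>x. x ^ Suc (Suc n) / fact (Suc (Suc n))) has_field_derivative
        x ^ Suc n / fact (Suc n)) (at x)"
      by (simp add: fact_Suc[of "Suc n"] del: of_nat_Suc fact_Suc power_Suc)
  qed
  ultimately show ?case by (simp add: exp_polynomial_Suc)
qed

text \<open>The truncated exponential as a formal polynomial, which makes degree, factorization and
  interpolation available.\<close>
definition trunc_exp_poly :: "nat \<Rightarrow> complex poly" where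
  "trunc_exp_poly m = (\<Sum>k\<le>m. monom (1 / fact k) k)"

lemma coeff_trunc_exp_poly:
  "coeff (trunc_exp_poly m) k = (if k \<le> m then 1 / fact k else 0)"
  by (simp add: trunc_exp_poly_def coeff_sum)

lemma poly_trunc_exp_poly: "poly (trunc_exp_poly m) = exp_polynomial m"
  by (simp add: trunc_exp_poly_def exp_polynomial_def poly_sum poly_monom fun_eq_iff)

lemma degree_trunc_exp_poly: "degree (trunc_exp_poly m) = m"
  by (rule antisym; intro degree_le le_degree) (simp_all add: coeff_trunc_exp_poly)

lemma pderiv_trunc_exp_poly: "pderiv (trunc_exp_poly (Suc n)) = trunc_exp_poly n"
  by (rule poly_eqI) (simp add: coeff_pderiv coeff_trunc_exp_poly divide_simps del: of_nat_Suc)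

lemma exp_polynomial_roots_nonzero: "a \<in> exp_polynomial_roots m \<Longrightarrow> a \<noteq> 0"
  by (auto simp: exp_polynomial_roots_def)

lemma exp_polynomial_at_root:
  assumes "a \<in> exp_polynomial_roots (Suc n)"
  shows "exp_polynomial n a = - (a ^ Suc n / fact (Suc n))"
  using assms by (simp add: exp_polynomial_roots_def exp_polynomial_Suc eq_neg_iff_add_eq_0)

text \<open>The roots are simple: at a double root \<open>a\<close> both \<open>E\<^sub>m(a)\<close> and \<open>E\<^sub>m'(a) = E\<^sub>m\<^sub>-\<^sub>1(a)\<close> vanish, hence so
  does \<open>a\<^sup>m\<close>, but \<open>0\<close> is not a root.\<close>
lemma exp_polynomial_factorization:
  assumes "m \<ge> 1"
  shows "smult (1 / fact m) (\<Prod>z\<in>exp_polynomial_roots m. [:- z, 1:]) = trunc_exp_poly m"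
proof -
  obtain n where n: "m = Suc n" using assms by (cases m) auto
  have "rsquarefree (trunc_exp_poly m)"
    unfolding rsquarefree_roots
  proof (safe)
    fix a assume a: "poly (trunc_exp_poly m) a = 0" "poly (pderiv (trunc_exp_poly m)) a = 0"
    then have "a \<in> exp_polynomial_roots (Suc n)" "exp_polynomial n a = 0"
      by (simp_all add: n pderiv_trunc_exp_poly poly_trunc_exp_poly exp_polynomial_roots_def)
    then show False
      using exp_polynomial_at_root[of a n] exp_polynomial_roots_nonzero[of a "Suc n"]
      by (simp del: fact_Suc)
  qed
  from complex_poly_decompose_rsquarefree[OF this] show ?thesis
    by (simp add: degree_trunc_exp_poly coeff_trunc_exp_poly poly_trunc_exp_poly
        exp_polynomial_roots_def)
qed

lemma finite_exp_polynomial_roots: "finite (exp_polynomial_roots m)"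
proof -
  have "trunc_exp_poly m \<noteq> 0"
    using coeff_trunc_exp_poly[of m 0] by auto
  from poly_roots_finite[OF this] show ?thesis
    by (simp add: poly_trunc_exp_poly exp_polynomial_roots_def)
qed

lemma card_exp_polynomial_roots:
  assumes "m \<ge> 1"
  shows "card (exp_polynomial_roots m) = m"
proof -
  have "m = degree (smult (1 / fact m) (\<Prod>z\<in>exp_polynomial_roots m. [:- z, 1:]))"
    by (simp add: exp_polynomial_factorization[OF assms] degree_trunc_exp_poly)
  also have "\<dots> = card (exp_polynomial_roots m)"
    by (simp add: degree_prod_eq_sum_degree)
  finally show ?thesis ..
qed

section \<open>An interpolation identity for sums over the roots\<close>

lemma lagrange_interpolation:
  fixes p :: "'a :: field poly"
  assumes "finite A" "degree p < card A"
  shows "poly p x = (\<Sum>a\<in>A. poly p a * ((\<Prod>b\<in>A - {a}. x - b) / (\<Prod>b\<in>A - {a}. a - b)))"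
proof -
  define q where "q = (\<Sum>a\<in>A. smult (poly p a / (\<Prod>b\<in>A - {a}. a - b)) (\<Prod>b\<in>A - {a}. [:- b, 1:]))"
  have poly_q: "poly q y = (\<Sum>a\<in>A. poly p a * ((\<Prod>b\<in>A - {a}. y - b) / (\<Prod>b\<in>A - {a}. a - b)))" for y
    by (simp add: q_def poly_sum poly_prod)
  have "p = q"
  proof (rule poly_eqI_degree)
    fix c assume c: "c \<in> A"
    have "poly q c = (\<Sum>a\<in>A. if a = c then poly p c else 0)"
      unfolding poly_q
    proof (intro sum.cong refl)
      fix a assume "a \<in> A"
      show "poly p a * ((\<Prod>b\<in>A - {a}. c - b) / (\<Prod>b\<in>A - {a}. a - b)) = (if a = c then poly p c else 0)"
        using c assms(1) by auto
    qed
    then show "poly p c = poly q c"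
      using c assms(1) by simp
  next
    show "degree q < card A"
      unfolding q_def
    proof (rule degree_sum_less)
      show "0 < card A" using assms(2) by simp
      fix a assume a: "a \<in> A"
      have "degree (\<Prod>b\<in>A - {a}. [:- b, 1:]) < card A"
        using a assms by (simp add: degree_prod_eq_sum_degree card_Diff_singleton)
      then show "degree (smult (poly p a / (\<Prod>b\<in>A - {a}. a - b)) (\<Prod>b\<in>A - {a}. [:- b, 1:])) < card A"
        using degree_smult_le le_less_trans by blast
    qed
  qed (fact assms(2))
  then show ?thesis using poly_q by metis
qed

text \<open>With \<open>R(x) = E\<^sub>m(x) / (x - a)\<close> the Lagrange weight of the node \<open>a\<close> at the point \<open>0\<close> is
  \<open>R(0) / R(a)\<close>, where \<open>R(0) = - 1 / a\<close> and \<open>R(a) = E\<^sub>m'(a) = - a\<^sup>m / m!\<close>.\<close>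
lemma exp_polynomial_lagrange_weight:
  assumes m: "m = Suc n" and a: "a \<in> exp_polynomial_roots m"
  shows "(\<Prod>b\<in>exp_polynomial_roots m - {a}. 0 - b) / (\<Prod>b\<in>exp_polynomial_roots m - {a}. a - b)
    = fact m / a ^ Suc m"
proof -
  define R where "R = smult (1 / fact m) (\<Prod>b\<in>exp_polynomial_roots m - {a}. [:- b, 1:])"
  have nz: "a \<noteq> 0" using a by (rule exp_polynomial_roots_nonzero)
  have E: "trunc_exp_poly m = [:- a, 1:] * R"
    using m a finite_exp_polynomial_roots[of m]
    by (simp add: R_def prod.remove flip: exp_polynomial_factorization)
  have "poly (pderiv (trunc_exp_poly m)) a = poly R a"
    unfolding E pderiv_mult by (simp add: pderiv_pCons)
  then have Ra: "poly R a = - (a ^ m / fact m)"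
    using exp_polynomial_at_root[of a n] a by (simp add: m pderiv_trunc_exp_poly poly_trunc_exp_poly)
  have "poly (trunc_exp_poly m) 0 = - a * poly R 0"
    by (simp add: E)
  then have "poly R 0 * a = - 1"
    by (simp add: poly_trunc_exp_poly minus_equation_iff[of "_ * _"] mult.commute)
  then have R0: "poly R 0 = - 1 / a"
    using nz by (metis nonzero_eq_divide_eq)
  have "(\<Prod>b\<in>exp_polynomial_roots m - {a}. 0 - b) / (\<Prod>b\<in>exp_polynomial_roots m - {a}. a - b)
      = poly R 0 / poly R a"
    by (simp add: R_def poly_prod)
  also have "\<dots> = fact m / a ^ Suc m"
    using nz by (simp add: R0 Ra)
  finally show ?thesis .
qed

lemma sum_roots_exp_polynomial:
  assumes m: "m = Suc n"
  shows "(\<Sum>a\<in>exp_polynomial_roots m. inverse a * (fact m / a ^ m * exp_polynomial n (a * c))) = 1"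
proof -
  define g where "g = pcompose (trunc_exp_poly n) [:0, c:]"
  have g: "poly g x = exp_polynomial n (x * c)" for x
    by (simp add: g_def poly_pcompose poly_trunc_exp_poly mult.commute)
  have "degree g \<le> n"
    unfolding g_def using degree_pcompose_le[of "trunc_exp_poly n" "[:0, c:]"]
    by (auto simp: degree_trunc_exp_poly split: if_splits)
  then have "degree g < card (exp_polynomial_roots m)"
    using card_exp_polynomial_roots[of m] m by simp
  from lagrange_interpolation[OF finite_exp_polynomial_roots this, of 0]
  have "1 = (\<Sum>a\<in>exp_polynomial_roots m. exp_polynomial n (a * c) * (fact m / a ^ Suc m))"
    by (simp add: g exp_polynomial_lagrange_weight[OF m] cong: sum.cong del: power_Suc diff_0)
  also have "\<dots> = (\<Sum>a\<in>exp_polynomial_roots m. inverse a * (fact m / a ^ m * exp_polynomial n (a * c)))"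
    by (intro sum.cong refl) (simp add: field_simps)
  finally show ?thesis by simp
qed

section \<open>The renewal equation on the unit interval\<close>

text \<open>The convolution of one exponential \<open>exp (- a s)\<close> with the polynomial \<open>m (1 - x)\<^sup>n\<close>,
  \<open>n = m - 1\<close>.\<close>
lemma has_bochner_integral_exp_root:
  assumes m: "m = Suc n" and a: "a \<in> exp_polynomial_roots m" and s: "0 \<le> s"
  shows "has_bochner_integral lborel
      (\<lambda>x. indicator {0..s} x *\<^sub>R (of_nat m * (1 - of_real x) ^ n * exp (- a * of_real (s - x))))
      (fact m / a ^ m * exp_polynomial n (a * (1 - of_real s)) + exp (- a * of_real s))"
proof -
  have nz: "a \<noteq> 0" using a by (rule exp_polynomial_roots_nonzero)
  define F where "F = (\<lambda>z::complex. fact m / a ^ m * exp (- a * (of_real s - z)) * exp_polynomial n (a * (1 - z)))"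
  have F': "(F has_field_derivative of_nat m * (1 - z) ^ n * exp (- a * (of_real s - z))) (at z)" for z
    \<comment> \<open>The derivative of \<open>exp y E\<^sub>n(- y)\<close> telescopes, since \<open>E\<^sub>n' = E\<^sub>n\<^sub>-\<^sub>1\<close>.\<close>
  proof (cases n)
    case 0
    then show ?thesis
      unfolding F_def using nz
      by (auto simp: exp_polynomial_def m intro!: derivative_eq_intros)
  next
    case (Suc k)
    have E: "((\<lambda>z. exp_polynomial n (a * (1 - z))) has_field_derivative
        exp_polynomial k (a * (1 - z)) * (- a)) (at z)"
      unfolding Suc by (rule DERIV_chain2[OF has_field_derivative_exp_polynomial])
        (auto intro!: derivative_eq_intros)
    have X: "((\<lambda>z. exp (- a * (of_real s - z))) has_field_derivative
        exp (- a * (of_real s - z)) * a) (at z)"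
      by (auto intro!: derivative_eq_intros)
    have regroup: "c * (e * a * p + q * (- a) * e) = c * e * a * (p - q)" for c e p q
      by (simp add: algebra_simps)
    have D: "(F has_field_derivative fact m / a ^ m * (exp (- a * (of_real s - z)) * a
        * exp_polynomial n (a * (1 - z)) +
          exp_polynomial k (a * (1 - z)) * (- a) * exp (- a * (of_real s - z)))) (at z)"
      using DERIV_cmult[OF DERIV_mult[OF X E], of "fact m / a ^ m"]
      by (simp only: F_def mult.assoc)
    have "fact m / a ^ m * exp (- a * (of_real s - z)) * a *
          (exp_polynomial n (a * (1 - z)) - exp_polynomial k (a * (1 - z)))
        = fact m / a ^ m * exp (- a * (of_real s - z)) * a * ((a * (1 - z)) ^ n / fact n)"
      by (simp add: Suc exp_polynomial_Suc)
    also have "\<dots> = of_nat m * (1 - z) ^ n * exp (- a * (of_real s - z))"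
      using nz by (simp add: m power_mult_distrib)
    finally show ?thesis using D unfolding regroup by simp
  qed
  have cont: "continuous_on {0..s}
      (\<lambda>x. of_nat m * (1 - of_real x) ^ n * exp (- a * of_real (s - x)) :: complex)"
    by (intro continuous_intros)
  have vd: "((\<lambda>x. F (of_real x)) has_vector_derivative
      of_nat m * (1 - of_real x) ^ n * exp (- a * of_real (s - x))) (at x within {0..s})" for x
    using has_vector_derivative_real_field[OF F', of x "{0..s}"] by (simp add: o_def)
  have "has_bochner_integral lborel
      (\<lambda>x. indicator {0..s} x *\<^sub>R (of_nat m * (1 - of_real x) ^ n * exp (- a * of_real (s - x))))
      (F (of_real s) - F (of_real 0))"
    using has_bochner_integral_FTC_Icc[OF s vd cont] by simp
  moreover have "F (of_real 0) = - exp (- a * of_real s)"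
    using nz a by (simp add: F_def exp_polynomial_at_root m del: power_Suc fact_Suc)
  ultimately show ?thesis
    by (simp add: F_def)
qed

text \<open>The candidate for \<open>1 + M\<close> on the unit interval. Setting it to \<open>0\<close> below \<open>0\<close> restricts convolutions to
  \<open>{0..s}\<close>; the cut-off above \<open>1\<close>, which no later argument reaches almost surely, makes the
  function bounded on the whole line.\<close>
definition beta_renewal_fun :: "nat \<Rightarrow> real \<Rightarrow> complex" where
  "beta_renewal_fun m s =
    (if 0 \<le> s \<and> s \<le> 1 then - (\<Sum>a\<in>exp_polynomial_roots m. inverse a * exp (- a * of_real s)) else 0)"

lemma borel_measurable_beta_renewal_fun [measurable]: "beta_renewal_fun m \<in> borel_measurable borel"
  unfolding beta_renewal_fun_def by measurable

lemma borel_measurable_beta_1_density [measurable]: "beta_1_density m \<in> borel_measurable borel"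
  unfolding beta_1_density_def by measurable

lemma beta_renewal_fun_bounded:
  obtains C where "\<And>s. norm (beta_renewal_fun m s) \<le> C"
proof
  fix s
  show "norm (beta_renewal_fun m s) \<le> (\<Sum>a\<in>exp_polynomial_roots m. norm (inverse a) * exp (norm a))"
  proof (cases "0 \<le> s \<and> s \<le> 1")
    case True
    have "norm (\<Sum>a\<in>exp_polynomial_roots m. inverse a * exp (- a * of_real s))
        \<le> (\<Sum>a\<in>exp_polynomial_roots m. norm (inverse a) * exp (norm a))"
    proof (intro sum_norm_le)
      fix a
      have "norm (exp (- a * of_real s)) \<le> exp (norm (- a * complex_of_real s))"
        by (rule norm_exp)
      also have "\<dots> \<le> exp (norm a)"
        using True by (auto simp: norm_mult intro: mult_left_le)
      finally show "norm (inverse a * exp (- a * of_real s)) \<le> norm (inverse a) * exp (norm a)"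
        by (simp add: norm_mult mult_left_mono del: norm_exp_eq_Re)
    qed
    then show ?thesis using True by (simp add: beta_renewal_fun_def)
  qed (auto simp: beta_renewal_fun_def intro!: sum_nonneg)
qed

lemma beta_renewal_equation:
  assumes "m \<ge> 1" and s: "s \<le> 1"
  shows "(LINT x|lborel. beta_1_density m x *\<^sub>R beta_renewal_fun m (s - x))
    = beta_renewal_fun m s - indicator {0..} s"
proof (cases "0 \<le> s")
  case False
  then have "(\<lambda>x. beta_1_density m x *\<^sub>R beta_renewal_fun m (s - x)) = (\<lambda>x. 0)"
    by (auto simp: beta_1_density_def beta_renewal_fun_def)
  then show ?thesis using False by (simp add: beta_renewal_fun_def)
next
  case True
  obtain n where m: "m = Suc n" using assms(1) by (cases m) auto
  let ?A = "exp_polynomial_roots m"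
  let ?f = "\<lambda>a x. indicator {0..s} x *\<^sub>R (of_nat m * (1 - of_real x) ^ n * exp (- a * of_real (s - x)))"
  let ?I = "\<lambda>a. fact m / a ^ m * exp_polynomial n (a * (1 - of_real s)) + exp (- a * of_real s)"
  have "(LINT x|lborel. beta_1_density m x *\<^sub>R beta_renewal_fun m (s - x))
      = (LINT x|lborel. - (\<Sum>a\<in>?A. inverse a * ?f a x))"
  proof (rule integral_cong_AE)
    show "AE x in lborel. beta_1_density m x *\<^sub>R beta_renewal_fun m (s - x)
        = - (\<Sum>a\<in>?A. inverse a * ?f a x)"
      \<comment> \<open>The density vanishes at \<open>0\<close> and \<open>1\<close>, where the polynomial need not.\<close>
      using AE_lborel_singleton[of 0] AE_lborel_singleton[of 1]
    proof eventually_elim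
      case (elim x)
      show ?case
      proof (cases "0 < x \<and> x \<le> s")
        case True
        then show ?thesis using elim s
          by (simp add: beta_1_density_def beta_renewal_fun_def m scaleR_conv_of_real
              sum_distrib_left mult_ac flip: sum_negf)
      next
        case False
        then show ?thesis using elim
          by (auto simp: beta_1_density_def beta_renewal_fun_def indicator_def)
      qed
    qed
  qed measurable
  also have "\<dots> = - (\<Sum>a\<in>?A. inverse a * ?I a)"
    by (intro has_bochner_integral_integral_eq has_bochner_integral_minus has_bochner_integral_sum
        has_bochner_integral_mult_right has_bochner_integral_exp_root m True)
  also have "\<dots> = beta_renewal_fun m s - 1"
    using True s sum_roots_exp_polynomial[OF m, of "1 - of_real s"]
    by (simp add: beta_renewal_fun_def distrib_left sum.distrib)
  finally show ?thesis using True by simp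
qed

section \<open>Telescoping along the random walk\<close>

context prob_space
begin

text \<open>One step of the walk: integrate out the new increment \<open>Y\<close> first, and use the renewal equation at
  \<open>t - S\<close>, which is at most \<open>1\<close> because \<open>S\<close> is nonnegative.\<close>
lemma expectation_beta_renewal_fun_step:
  assumes m: "m \<ge> 1" and indep: "indep_var borel Y borel S"
    and Y: "distributed M lborel Y (\<lambda>x. ennreal (beta_1_density m x))"
    and S: "AE \<omega> in M. 0 \<le> S \<omega>" and t: "t \<le> 1"
  shows "(LINT \<omega>|M. beta_renewal_fun m (t - (S \<omega> + Y \<omega>)))
    = (LINT \<omega>|M. beta_renewal_fun m (t - S \<omega>)) - of_real (prob {\<omega>\<in>space M. S \<omega> \<le> t})"
proof -
  let ?U = "beta_renewal_fun m"
  have [measurable]: "random_variable borel Y" "random_variable borel S"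
    using indep by (auto dest: indep_var_rv1 indep_var_rv2)
  obtain C where C: "\<And>s. norm (?U s) \<le> C" using beta_renewal_fun_bounded by blast
  have "distr M borel Y = distr M lborel Y"
    by (rule distr_cong) auto
  also have "\<dots> = density lborel (\<lambda>x. ennreal (beta_1_density m x))"
    by (rule distributed_distr_eq_density[OF Y])
  finally have dY: "distr M borel Y = density lborel (\<lambda>x. ennreal (beta_1_density m x))" .
  have pairD: "distr M borel Y \<Otimes>\<^sub>M distr M borel S = distr M (borel \<Otimes>\<^sub>M borel) (\<lambda>\<omega>. (Y \<omega>, S \<omega>))"
    using indep by (simp add: indep_var_distribution_eq)
  interpret DY: prob_space "distr M borel Y" by (rule prob_space_distr) simp
  interpret DS: prob_space "distr M borel S" by (rule prob_space_distr) simp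
  interpret DP: pair_prob_space "distr M borel Y" "distr M borel S" ..
  have int: "integrable (distr M borel Y \<Otimes>\<^sub>M distr M borel S) (\<lambda>z. ?U (t - (snd z + fst z)))"
    by (rule DP.P.integrable_const_bound[where B=C]) (auto simp: C)
  have "(LINT \<omega>|M. ?U (t - (S \<omega> + Y \<omega>)))
      = (LINT z|distr M (borel \<Otimes>\<^sub>M borel) (\<lambda>\<omega>. (Y \<omega>, S \<omega>)). ?U (t - (snd z + fst z)))"
    by (subst integral_distr) simp_all
  also have "\<dots> = (LINT y|distr M borel S. LINT x|distr M borel Y. ?U (t - (y + x)))"
    unfolding pairD[symmetric]
    using DP.integral_snd[of "\<lambda>x y. ?U (t - (y + x))"] int
    by (simp add: split_beta')
  also have "\<dots> = (LINT y|distr M borel S. LINT x|lborel. beta_1_density m x *\<^sub>R ?U (t - y - x))"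
    unfolding dY by (subst integral_density) (auto simp: beta_1_density_def diff_diff_eq)
  also have "\<dots> = (LINT \<omega>|M. LINT x|lborel. beta_1_density m x *\<^sub>R ?U (t - S \<omega> - x))"
    by (rule integral_distr) measurable
  also have "\<dots> = (LINT \<omega>|M. ?U (t - S \<omega>) - of_real (indicator {\<omega>\<in>space M. S \<omega> \<le> t} \<omega>))"
  proof (rule integral_cong_AE)
    show "AE \<omega> in M. (LINT x|lborel. beta_1_density m x *\<^sub>R ?U (t - S \<omega> - x))
        = ?U (t - S \<omega>) - of_real (indicator {\<omega>\<in>space M. S \<omega> \<le> t} \<omega>)"
      using S AE_space
    proof eventually_elim
      case (elim \<omega>)
      then have "t - S \<omega> \<le> 1" using t by simp
      from beta_renewal_equation[OF m this] elim show ?case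
        by (simp add: indicator_def)
    qed
  qed measurable
  also have "\<dots> = (LINT \<omega>|M. ?U (t - S \<omega>)) - (LINT \<omega>|M. complex_of_real (indicator {\<omega>\<in>space M. S \<omega> \<le> t} \<omega>))"
  proof (rule Bochner_Integration.integral_diff)
    show "integrable M (\<lambda>\<omega>. ?U (t - S \<omega>))"
      by (rule integrable_const_bound[where B=C]) (auto simp: C)
    show "integrable M (\<lambda>\<omega>. complex_of_real (indicator {\<omega>\<in>space M. S \<omega> \<le> t} \<omega>))"
      by (intro integrable_of_real integrable_real_indicator) (auto simp: emeasure_eq_measure)
  qed
  also have "(LINT \<omega>|M. complex_of_real (indicator {\<omega>\<in>space M. S \<omega> \<le> t} \<omega>))
      = of_real (prob {\<omega>\<in>space M. S \<omega> \<le> t})"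
    by simp
  finally show ?thesis .
qed

lemma AE_beta_nonneg:
  assumes "distributed M lborel Y (\<lambda>x. ennreal (beta_1_density m x))"
  shows "AE \<omega> in M. 0 \<le> Y \<omega>"
proof -
  have "AE \<omega> in M. 0 < Y \<omega>"
    by (subst distributed_AE2[OF assms]) (auto simp: beta_1_density_def)
  then show ?thesis by eventually_elim simp
qed

text \<open>The sum over \<open>n\<close> includes \<open>S\<^sub>0 = 0\<close>.\<close>
lemma renewal_sums:
  fixes X :: "nat \<Rightarrow> 'a \<Rightarrow> real"
  assumes m: "m \<ge> 1" and indep: "indep_vars (\<lambda>_. borel) X {1..}"
    and X: "\<And>n. n \<ge> 1 \<Longrightarrow> distributed M lborel (X n) (\<lambda>x. ennreal (beta_1_density m x))"
    and t: "t \<in> {0..1}"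
  shows "(\<lambda>n. complex_of_real (prob {\<omega>\<in>space M. partial_sum X n \<omega> \<le> t})) sums beta_renewal_fun m t"
    and "summable (\<lambda>n. prob {\<omega>\<in>space M. partial_sum X n \<omega> \<le> t})"
proof -
  let ?U = "beta_renewal_fun m"
  let ?p = "\<lambda>n. prob {\<omega>\<in>space M. partial_sum X n \<omega> \<le> t}"
  let ?r = "\<lambda>n. LINT \<omega>|M. ?U (t - partial_sum X n \<omega>)"
  have X_meas [measurable]: "random_variable borel (X n)" if "n \<ge> 1" for n
    using indep that by (auto simp: indep_vars_def)
  have S_meas [measurable]: "random_variable borel (partial_sum X n)" for n
    unfolding partial_sum_def by (intro borel_measurable_sum) (auto intro: X_meas)
  have S_nonneg: "AE \<omega> in M. 0 \<le> partial_sum X n \<omega>" for n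
  proof -
    have "AE \<omega> in M. \<forall>i\<in>{1..n}. 0 \<le> X i \<omega>"
      by (intro AE_finite_allI AE_beta_nonneg[OF X]) auto
    then show ?thesis
      by eventually_elim (auto simp: partial_sum_def intro: sum_nonneg)
  qed
  have step: "?r (Suc n) = ?r n - of_real (?p n)" for n
  proof -
    have "indep_vars (\<lambda>_. borel) X (insert (Suc n) {1..n})"
      by (rule indep_vars_subset[OF indep]) auto
    from indep_vars_sum[OF _ _ this]
    have "indep_var borel (X (Suc n)) borel (partial_sum X n)"
      by (simp add: partial_sum_def[abs_def])
    from expectation_beta_renewal_fun_step[OF m this X S_nonneg] t show ?thesis
      by (simp add: partial_sum_def)
  qed
  have telescope: "(\<Sum>k<n. of_real (?p k)) = ?U t - ?r n" for n
  proof (induction n)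
    case 0
    show ?case by (simp add: partial_sum_def prob_space)
  qed (simp add: step)
  obtain C where C: "\<And>s. norm (?U s) \<le> C" using beta_renewal_fun_bounded by blast
  have r_bound: "norm (?r n) \<le> C * ?p n" for n
  proof -
    have int: "integrable M (\<lambda>\<omega>. ?U (t - partial_sum X n \<omega>))"
      by (rule integrable_const_bound[where B=C]) (auto simp: C)
    have "norm (?r n) \<le> (LINT \<omega>|M. norm (?U (t - partial_sum X n \<omega>)))"
      by (rule integral_norm_bound)
    also have "\<dots> \<le> (LINT \<omega>|M. C * indicator {\<omega>\<in>space M. partial_sum X n \<omega> \<le> t} \<omega>)"
    proof (rule integral_mono)
      show "norm (?U (t - partial_sum X n \<omega>)) \<le> C * indicator {\<omega>\<in>space M. partial_sum X n \<omega> \<le> t} \<omega>"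
        if "\<omega> \<in> space M" for \<omega>
        using that C[of "t - partial_sum X n \<omega>"] by (auto simp: indicator_def beta_renewal_fun_def)
    qed (use int in \<open>auto simp: emeasure_eq_measure
          intro!: integrable_mult_right integrable_real_indicator\<close>)
    finally show ?thesis by simp
  qed
  have C0: "0 \<le> C" using C[of 0] norm_ge_zero order_trans by blast
  \<comment> \<open>The trivial bound \<open>P(S\<^sub>n \<le> t) \<le> 1\<close> in the estimate of the remainder already bounds the partial sums.\<close>
  show sm: "summable ?p"
  proof (rule summableI_nonneg_bounded)
    fix n
    have "(\<Sum>k<n. ?p k) = norm (\<Sum>k<n. complex_of_real (?p k))"
      by (simp flip: of_real_sum add: sum_nonneg)
    also have "\<dots> \<le> norm (?U t) + norm (?r n)"
      unfolding telescope by (rule norm_triangle_ineq4)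
    also have "\<dots> \<le> C + C * 1"
      by (intro add_mono C order_trans[OF r_bound] mult_left_mono C0) simp
    finally show "(\<Sum>k<n. ?p k) \<le> C + C * 1" .
  qed simp
  have "(\<lambda>n. C * ?p n) \<longlonglongrightarrow> 0"
    using tendsto_mult_right_zero[OF summable_LIMSEQ_zero[OF sm]] .
  then have "?r \<longlonglongrightarrow> 0"
    by (rule Lim_null_comparison[rotated]) (simp add: r_bound)
  from tendsto_diff[OF tendsto_const[of "?U t"] this]
  show "(\<lambda>n. complex_of_real (?p n)) sums ?U t"
    by (simp add: sums_def telescope)
qed

end

theorem theorem5p8:
  fixes P :: "'a measure" and X :: "nat \<Rightarrow> 'a \<Rightarrow> real" and m :: nat
  assumes "m \<ge> 1"
    and "prob_space P"
    and "prob_space.indep_vars P (\<lambda>_. borel) X {1..}"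
    and "\<And>n. n \<ge> 1 \<Longrightarrow> distributed P lborel (X n) (\<lambda>x. ennreal (beta_1_density m x))"
  shows "card (exp_polynomial_roots m) = m \<and>
    (\<forall>t\<in>{0..1}. renewal_mean P X t < \<infinity> \<and>
      complex_of_real (enn2real (renewal_mean P X t)) =
        - 1 - (\<Sum>\<alpha>\<in>exp_polynomial_roots m. inverse \<alpha> * exp (- \<alpha> * complex_of_real t)))"
proof (intro conjI ballI card_exp_polynomial_roots assms(1))
  interpret prob_space P by fact
  fix t :: real assume t: "t \<in> {0..1}"
  let ?p = "\<lambda>n. prob {\<omega>\<in>space P. partial_sum X n \<omega> \<le> t}"
  note * = renewal_sums[OF assms(1,3,4) t]
  have X_meas: "random_variable borel (X n)" if "n \<ge> 1" for n
    using assms(3) that by (auto simp: indep_vars_def)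
  have [measurable]: "random_variable borel (partial_sum X n)" for n
    unfolding partial_sum_def by (intro borel_measurable_sum) (auto intro: X_meas)
  have summable_Suc: "summable (\<lambda>n. ?p (Suc n))"
    using *(2) by (subst summable_Suc_iff)
  have "renewal_mean P X t
      = (\<integral>\<^sup>+ \<omega>. (\<Sum>n. indicator {\<omega>\<in>space P. partial_sum X (Suc n) \<omega> \<le> t} \<omega>) \<partial>P)"
    unfolding renewal_mean_def renewal_count_def
    by (intro nn_integral_cong suminf_cong) (auto simp: indicator_def)
  also have "\<dots> = (\<Sum>n. ennreal (?p (Suc n)))"
    by (subst nn_integral_suminf) (auto simp: emeasure_eq_measure)
  also have "\<dots> = ennreal (\<Sum>n. ?p (Suc n))"
    by (intro suminf_ennreal_eq summable_sums summable_Suc) simp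
  finally have M: "renewal_mean P X t = ennreal (\<Sum>n. ?p (Suc n))" .
  then show "renewal_mean P X t < \<infinity>" by simp
  \<comment> \<open>The renewal count starts at \<open>S\<^sub>1\<close>; the missing term \<open>n = 0\<close> accounts for the summand \<open>- 1\<close>.\<close>
  have p0: "?p 0 = 1"
    using t by (simp add: partial_sum_def prob_space)
  have "complex_of_real (enn2real (renewal_mean P X t)) = of_real (\<Sum>n. ?p (Suc n))"
    by (simp add: M suminf_nonneg summable_Suc)
  also have "\<dots> = of_real (suminf ?p) - 1"
    by (simp add: suminf_split_head[OF *(2)] p0)
  also have "complex_of_real (suminf ?p) = beta_renewal_fun m t"
    using *(1) sums_unique2 sums_of_real[OF summable_sums[OF *(2)]] by blast
  finally show "complex_of_real (enn2real (renewal_mean P X t)) =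
        - 1 - (\<Sum>\<alpha>\<in>exp_polynomial_roots m. inverse \<alpha> * exp (- \<alpha> * complex_of_real t))"
    using t by (simp add: beta_renewal_fun_def)
qed

end
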